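(* Let $k=2r\ge 4$ be an even integer, let $\ell,n$ be positive integers with $2k\le\ell$ and $n\ge100\,k\ell$, let $s=\bigl\lceil\frac{3\ell}{k}\log\frac{en}{\ell}\bigr\rceil$ and $N=\binom n\ell$. Let $\mathcal H\subseteq\binom{[n]}{k}$ be a nonempty $k$-uniform hypergraph with no even cover of size at most $\max\{2s,\ \ell+ks+1\}$. Then every state of the truncated lift of $\mathcal H$ has in-degree at most $2\ell$ under the representative orientation (defined in the context, for any choice of the representative systems $\rho_W$), and $$\|K\|\ \le\ 2\sqrt{\frac{2\ell}{\bar d}}\;N^{1/(2s)},$$ where $K$ is the normalized Kikuchi matrix of $\mathcal H$, $\bar d$ is the average degree of its Kikuchi graph, and $\|\cdot\|$ is the operator (spectral) norm.
   Context: A $k$-uniform hypergraph on $[n]=\{1,\dots,n\}$ is a set $\mathcal H$ of $k$-element subsets of $[n]$; a nonempty $\mathcal C\subseteq\mathcal H$ is an even cover (of size $|\mathcal C|$) if every vertex lies in an even number of members of $\mathcal C$; $\triangle$ is symmetric difference; logarithms are natural. Kikuchi graph: $G$ is the graph on $\Omega_\ell=\binom{[n]}\ell$ (elements are called rows) in which a hyperedge $F\in\mathcal H$ joins $S$ to $S\triangle F$ whenever $|S\cap F|=r$. $A_G$ is its adjacency matrix, $d(S)$ the degree of $S$, and $\bar d=N^{-1}\sum_S d(S)$, positive when $\mathcal H\ne\varnothing$. Put $\Gamma=\operatorname{diag}(d(S))+\bar d\,I$ and $K=\Gamma^{-1/2}A_G\Gamma^{-1/2}$. Truncated lift: states are pairs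 $x=(S,M)$ with $S\in\Omega_\ell$, $M\subseteq\mathcal H$ (the memory) and $|M|\le s$. For each $F\in\mathcal H$ with $|S\cap F|=r$ there is a lifted edge labeled $F$ between $(S,M)$ and $(S\triangle F,\,M\triangle\{F\})$ (provided both are states). Restrict to the union of the connected components containing some state $(S,\varnothing)$. Supports: for a state $x=(S,M)$ put $W(x)=S\cup\bigcup_{F\in M}F$, so $|W(x)|\le\ell+ks$. Along a lifted edge labeled $F$, if $F$ lies in the memory of $x$ but not in that of $y$ then $W(x)=W(y)\cup F\supseteq W(y)$, so the two supports are nested. Representative orientation: for each $W\subseteq[n]$ with $|W|\le\ell+ks$ fix a system of distinct representatives $\rho_W$ of $\mathcal H[W]=\{F\in\mathcal H:F\subseteq W\}$, i.e. an injective map $\rho_W:\mathcal H[W]\to W$ with $\rho_W(F)\in F$ (such systems exist when $\mathcal H$ has no even cover of size at most $\ell+ks+1$). Orient a lifted edge labeled $F$ with endpoints $x,y$ as follows: if $W(x)=W(y)=W$, orient it toward the endpoint whose row contains $\rho_W(F)$ (exactly one of the two rows does); if $W(x)\ne W(y)$, orient it toward the endpoint with the larger support. *)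

theory Defs
  imports "HOL-Analysis.Analysis" "HOL-Library.Ramsey"
begin

definition even_cover :: "nat \<Rightarrow> nat set set \<Rightarrow> nat set set \<Rightarrow> bool" where
  "even_cover n H C \<longleftrightarrow>
     C \<noteq> {} \<and> C \<subseteq> H \<and> (\<forall>v\<in>{1..n}. even (card {F \<in> C. v \<in> F}))"

definition kikuchi_rows :: "nat \<Rightarrow> nat \<Rightarrow> nat set set" where
  "kikuchi_rows n l = nsets {1..n} l"


(* The edge S -- T has the unique possible label F = sym_diff S T, so the Kikuchi graph is simple;
   for hyperedges of size 2r the relation is symmetric and preserves the size of S. *)
definition kikuchi_adj :: "nat \<Rightarrow> nat \<Rightarrow> nat \<Rightarrow> nat set set \<Rightarrow> nat set \<Rightarrow> nat set \<Rightarrow> bool" where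
  "kikuchi_adj n l r H S T \<longleftrightarrow>
     S \<in> kikuchi_rows n l \<and> T \<in> kikuchi_rows n l \<and> (\<exists>F\<in>H. card (S \<inter> F) = r \<and> T = sym_diff S F)"

definition kikuchi_matrix :: "nat \<Rightarrow> nat \<Rightarrow> nat \<Rightarrow> nat set set \<Rightarrow> nat set \<Rightarrow> nat set \<Rightarrow> real" where
  "kikuchi_matrix n l r H S T = (if kikuchi_adj n l r H S T then 1 else 0)"

definition kikuchi_degree :: "nat \<Rightarrow> nat \<Rightarrow> nat \<Rightarrow> nat set set \<Rightarrow> nat set \<Rightarrow> nat" where
  "kikuchi_degree n l r H S = card {T. kikuchi_adj n l r H S T}"

definition avg_degree :: "nat \<Rightarrow> nat \<Rightarrow> nat \<Rightarrow> nat set set \<Rightarrow> real" where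
  "avg_degree n l r H =
     (\<Sum>S\<in>kikuchi_rows n l. real (kikuchi_degree n l r H S)) / real (n choose l)"

(* The diagonal entries of the diagonal matrix Gamma. *)
definition Gamma_diag :: "nat \<Rightarrow> nat \<Rightarrow> nat \<Rightarrow> nat set set \<Rightarrow> nat set \<Rightarrow> real" where
  "Gamma_diag n l r H S = real (kikuchi_degree n l r H S) + avg_degree n l r H"

(* Entries of Gamma^(-1/2) A_G Gamma^(-1/2). *)
definition normalized_kikuchi ::
    "nat \<Rightarrow> nat \<Rightarrow> nat \<Rightarrow> nat set set \<Rightarrow> nat set \<Rightarrow> nat set \<Rightarrow> real" where
  "normalized_kikuchi n l r H S T =
     Gamma_diag n l r H S powr (-1/2) * kikuchi_matrix n l r H S T * Gamma_diag n l r H T powr (-1/2)"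

(* The l2 -> l2 operator norm of a real square matrix with rows and columns indexed by the
   finite set I; values of A and x outside I are irrelevant. *)
definition op_norm_on :: "'a set \<Rightarrow> ('a \<Rightarrow> 'a \<Rightarrow> real) \<Rightarrow> real" where
  "op_norm_on I A =
     (SUP x\<in>{x. L2_set x I \<le> 1}. L2_set (\<lambda>i. \<Sum>j\<in>I. A i j * x j) I)"


type_synonym lift_state = "nat set \<times> nat set set"

(* All pairs (row, memory), before restricting to the components of the states (S, {}). *)
definition lift_pairs :: "nat \<Rightarrow> nat \<Rightarrow> nat \<Rightarrow> nat set set \<Rightarrow> lift_state set" where
  "lift_pairs n l s H = {(S, M). S \<in> kikuchi_rows n l \<and> M \<subseteq> H \<and> card M \<le> s}"

definition lift_edge ::
    "nat \<Rightarrow> nat \<Rightarrow> nat \<Rightarrow> nat \<Rightarrow> nat set set \<Rightarrow> nat set \<Rightarrow> lift_state \<Rightarrow> lift_state \<Rightarrow> bool" where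
  "lift_edge n l r s H F x y \<longleftrightarrow>
     x \<in> lift_pairs n l s H \<and> y \<in> lift_pairs n l s H \<and> F \<in> H \<and> card (fst x \<inter> F) = r \<and>
     fst y = sym_diff (fst x) F \<and> snd y = sym_diff (snd x) {F}"

definition lift_states :: "nat \<Rightarrow> nat \<Rightarrow> nat \<Rightarrow> nat \<Rightarrow> nat set set \<Rightarrow> lift_state set" where
  "lift_states n l r s H =
     {y. \<exists>S\<in>kikuchi_rows n l. (\<lambda>u v. \<exists>F. lift_edge n l r s H F u v)\<^sup>*\<^sup>* (S, {}) y}"

definition lift_support :: "lift_state \<Rightarrow> nat set" where
  "lift_support x = fst x \<union> \<Union> (snd x)"

definition induced_edges :: "nat set set \<Rightarrow> nat set \<Rightarrow> nat set set" where
  "induced_edges H W = {F \<in> H. F \<subseteq> W}"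

definition rep_system :: "nat set set \<Rightarrow> nat set \<Rightarrow> (nat set \<Rightarrow> nat) \<Rightarrow> bool" where
  "rep_system H W f \<longleftrightarrow>
     f \<in> induced_edges H W \<rightarrow> W \<and> inj_on f (induced_edges H W) \<and> (\<forall>F\<in>induced_edges H W. f F \<in> F)"

(* The lifted edge labeled F with endpoints x, y is oriented toward y.  The supports of the
   endpoints of a lifted edge are nested, so the larger one is the strict superset. *)
definition oriented_toward ::
    "(nat set \<Rightarrow> nat set \<Rightarrow> nat) \<Rightarrow> nat set \<Rightarrow> lift_state \<Rightarrow> lift_state \<Rightarrow> bool" where
  "oriented_toward \<rho> F x y \<longleftrightarrow>
     (if lift_support x = lift_support y then \<rho> (lift_support y) F \<in> fst y else lift_support x \<subset> lift_support y)"

definition lift_in_degree ::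
    "nat \<Rightarrow> nat \<Rightarrow> nat \<Rightarrow> nat \<Rightarrow> nat set set \<Rightarrow> (nat set \<Rightarrow> nat set \<Rightarrow> nat) \<Rightarrow> lift_state \<Rightarrow> nat" where
  "lift_in_degree n l r s H \<rho> y =
     card {(x, F). x \<in> lift_states n l r s H \<and> lift_edge n l r s H F x y \<and> oriented_toward \<rho> F x y}"

end

theory Submission
  imports Defs
begin

text \<open>For edges into a lifted state with row \<open>S\<close>, the labels are charged injectively to \<open>S\<close>:
  by the representative if the supports agree, and by a vertex leaving the support otherwise.
  This gives in-degree at most \<open>2 * l\<close>, and Cauchy--Schwarz over the oriented edges
  bounds the norm of the normalized lifted matrix by \<open>c = 2 * sqrt (2 * l / d)\<close>. In the absence of
  even covers of size at most \<open>2 * s\<close>, the endpoint of a walk of length \<open>s\<close> from \<open>S\<close> determines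
  the final memory, so the columns of \<open>K ^ s\<close> are as long as those of the \<open>s\<close>-th
  power of the lifted matrix, namely at most \<open>c ^ s\<close>. Hence \<open>\<parallel>K ^ s\<parallel> \<le> sqrt N * c ^ s\<close>. For symmetric \<open>K\<close>
  the sequence \<open>\<parallel>K ^ t x\<parallel>\<close> is log-convex in \<open>t\<close>, which gives \<open>\<parallel>K x\<parallel> ^ s \<le> \<parallel>K ^ s x\<parallel>\<close> for
  unit vectors without diagonalizing \<open>K\<close>.\<close>

section \<open>Even covers and systems of representatives\<close>

lemma odd_card_sym_diff:
  assumes "finite A" "finite B"
  shows "odd (card (sym_diff A B)) \<longleftrightarrow> odd (card A) \<noteq> odd (card B)"
proof -
  have "card (sym_diff A B) = card (A - B) + card (B - A)"
    using assms by (intro card_Un_disjoint) auto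
  moreover have "card A = card (A - B) + card (A \<inter> B)"
    using assms card_Diff_subset_Int[of A B] card_mono[of A "A \<inter> B"] by auto
  moreover have "card B = card (B - A) + card (A \<inter> B)"
    using assms card_Diff_subset_Int[of B A] card_mono[of B "A \<inter> B"] by (auto simp: Int_commute)
  ultimately show ?thesis by auto
qed

text \<open>The sum over the two-element field of the indicator vectors \<open>e i\<close> with
  \<open>i \<in> J\<close>. It is indexed by a family so that a coordinate can be deleted from every
  vector while the index set stays fixed.\<close>

definition odd_part :: "('i \<Rightarrow> 'v set) \<Rightarrow> 'i set \<Rightarrow> 'v set" where
  "odd_part e J = {v. odd (card {i \<in> J. v \<in> e i})}"

lemma odd_part_empty [simp]: "odd_part e {} = {}"
  by (simp add: odd_part_def)

lemma odd_part_singleton [simp]: "odd_part e {i} = e i"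
proof -
  have "{j. j = i \<and> v \<in> e j} = (if v \<in> e i then {i} else {})" for v by auto
  then show ?thesis by (auto simp: odd_part_def)
qed

lemma odd_part_sym_diff:
  assumes "finite J" "finite K"
  shows "odd_part e (sym_diff J K) = sym_diff (odd_part e J) (odd_part e K)"
proof -
  have "{i \<in> sym_diff J K. v \<in> e i} = sym_diff {i \<in> J. v \<in> e i} {i \<in> K. v \<in> e i}" for v
    by auto
  then have "odd (card {i \<in> sym_diff J K. v \<in> e i}) \<longleftrightarrow>
      odd (card {i \<in> J. v \<in> e i}) \<noteq> odd (card {i \<in> K. v \<in> e i})" for v
    using assms by (simp add: odd_card_sym_diff)
  then show ?thesis unfolding odd_part_def by auto
qed

text \<open>Spans are closed under symmetric difference, and \<open>V\<close> is the sum of its unit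
  vectors. Used in contrapositive form: a finite set outside the span has an element whose unit
  vector is outside it too.\<close>

lemma singletons_span_odd_part:
  assumes "finite V" "finite I" "\<And>v. v \<in> V \<Longrightarrow> \<exists>J\<subseteq>I. odd_part e J = {v}"
  shows "\<exists>J\<subseteq>I. odd_part e J = V"
  using assms(1,3)
proof (induction V rule: finite_induct)
  case empty
  show ?case by (intro exI[of _ "{}"]) simp
next
  case (insert v V)
  obtain J K where "J \<subseteq> I" "odd_part e J = {v}" "K \<subseteq> I" "odd_part e K = V"
    using insert by (metis insertCI)
  moreover from this have "finite J" "finite K" using assms(2) finite_subset by auto
  ultimately show ?case using insert.hyps
    by (intro exI[of _ "sym_diff J K"]) (auto simp: odd_part_sym_diff)
qed

text \<open>A vector \<open>e m\<close> outside the span over the two-element field of the other vectors \<open>e i\<close>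
  contains a \<open>v\<close> such that the unit vector \<open>{v}\<close> is outside that span; deleting coordinate
  \<open>v\<close> then keeps the other vectors independent.\<close>

lemma independent_sets_have_representatives:
  fixes e :: "'i \<Rightarrow> 'v set"
  assumes "finite I" "\<And>i. i \<in> I \<Longrightarrow> finite (e i)"
    and "\<And>J. J \<subseteq> I \<Longrightarrow> J \<noteq> {} \<Longrightarrow> odd_part e J \<noteq> {}"
  shows "\<exists>f. inj_on f I \<and> (\<forall>i\<in>I. f i \<in> e i)"
  using assms
proof (induction I arbitrary: e rule: finite_induct)
  case empty
  show ?case by simp
next
  case (insert m I)
  have "\<not> (\<exists>J\<subseteq>I. odd_part e J = e m)"
  proof
    assume "\<exists>J\<subseteq>I. odd_part e J = e m"
    then obtain J where J: "J \<subseteq> I" "odd_part e J = e m" by auto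
    then have "finite J" using insert.hyps finite_subset by auto
    then have "odd_part e (sym_diff J {m}) = {}"
      using J by (simp add: odd_part_sym_diff del: Diff_insert0)
    moreover have "sym_diff J {m} \<subseteq> insert m I" "sym_diff J {m} \<noteq> {}"
      using J insert.hyps by auto
    ultimately show False using insert.prems(2) by blast
  qed
  moreover have "finite (e m)" using insert.prems(1) by simp
  ultimately obtain v where v: "v \<in> e m" "\<not> (\<exists>J\<subseteq>I. odd_part e J = {v})"
    using singletons_span_odd_part[OF _ \<open>finite I\<close>, of "e m" e] by blast
  have del: "odd_part (\<lambda>i. e i - {v}) J = odd_part e J - {v}" for J
  proof -
    have "{i \<in> J. u \<in> e i \<and> u \<noteq> v} = (if u = v then {} else {i \<in> J. u \<in> e i})" for u by auto
    then show ?thesis by (auto simp: odd_part_def)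
  qed
  \<comment> \<open>A sum that vanishes after deleting \<open>v\<close> was empty before, a
    dependency, or equal to \<open>{v}\<close>, which the choice of \<open>v\<close>
    excludes.\<close>
  have "odd_part (\<lambda>i. e i - {v}) J \<noteq> {}" if "J \<subseteq> I" "J \<noteq> {}" for J
  proof -
    have "odd_part e J \<noteq> {}" using insert.prems(2) that by blast
    then show ?thesis using v(2) that unfolding del by blast
  qed
  then obtain f where f: "inj_on f I" "\<forall>i\<in>I. f i \<in> e i - {v}"
    using insert.IH[of "\<lambda>i. e i - {v}"] insert.prems(1) by auto
  have "inj_on (f(m := v)) (insert m I)"
    using f insert.hyps by (auto simp: inj_on_def)
  moreover have "\<forall>i\<in>insert m I. (f(m := v)) i \<in> e i" using f(2) v(1) by simp
  ultimately show ?case by blast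
qed

text \<open>Vertices outside \<open>{1..n}\<close> lie in no hyperedge, so even covers are exactly
  the linear dependencies.\<close>

lemma even_cover_iff_odd_part:
  assumes "H \<subseteq> Pow {1..n}"
  shows "even_cover n H C \<longleftrightarrow> C \<noteq> {} \<and> C \<subseteq> H \<and> odd_part id C = {}"
proof -
  have "v \<in> {1..n}" if "v \<in> odd_part id C" "C \<subseteq> H" for v
  proof -
    have "{F \<in> C. v \<in> F} \<noteq> {}" using that by (force simp: odd_part_def)
    then show ?thesis using that assms by blast
  qed
  then have "odd_part id C = {} \<longleftrightarrow> (\<forall>v\<in>{1..n}. v \<notin> odd_part id C)" if "C \<subseteq> H"
    using that by blast
  then show ?thesis unfolding even_cover_def
    by (simp add: odd_part_def) blast
qed

text \<open>Only covers with at most \<open>card W + 1\<close> edges are excluded, yet all of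
  \<open>induced_edges H W\<close> must be independent. This suffices because a smallest dependency
  inside \<open>W\<close> is no larger than that; hence the bound \<open>l + k * s + 1\<close> in
  the theorem.\<close>

lemma rep_system_exists:
  assumes H: "H \<subseteq> Pow {1..n}" and W: "finite W"
    and no: "\<not> (\<exists>C. even_cover n H C \<and> card C \<le> card W + 1)"
  shows "\<exists>f. rep_system H W f"
proof -
  have fH: "finite H" using H finite_subset by blast
  have fin: "finite F" if "F \<in> H" for F using that H finite_subset by blast
  have rep: "\<exists>f. inj_on f E \<and> (\<forall>F\<in>E. f F \<in> F)"
    if "E \<subseteq> H" "\<And>C. C \<subseteq> E \<Longrightarrow> \<not> even_cover n H C" for E
  proof -
    have "odd_part id J \<noteq> {}" if "J \<subseteq> E" "J \<noteq> {}" for J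
      using \<open>E \<subseteq> H\<close> that(1,2) \<open>\<And>C. C \<subseteq> E \<Longrightarrow> \<not> even_cover n H C\<close>[of J]
      by (simp add: even_cover_iff_odd_part[OF H])
    then show ?thesis
      using independent_sets_have_representatives[of E id] that(1) fin finite_subset[OF that(1) fH]
      by (simp add: subset_iff)
  qed
  \<comment> \<open>A minimal even cover minus one edge is independent, so its size is at most that of \<open>W\<close>.\<close>
  have "\<not> even_cover n H C" if "C \<subseteq> induced_edges H W" for C
  proof
    assume "even_cover n H C"
    define P where "P = (\<lambda>C. C \<subseteq> induced_edges H W \<and> even_cover n H C)"
    have "P C" using that \<open>even_cover n H C\<close> by (simp add: P_def)
    then obtain D where D: "P D" and min: "\<And>C. P C \<Longrightarrow> card D \<le> card C"
      using ex_has_least_nat[of P C card] by blast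
    have DW: "D \<subseteq> induced_edges H W" and DH: "D \<subseteq> H" "D \<noteq> {}"
      using D by (auto simp: P_def even_cover_def)
    have fD: "finite D" using DH fH finite_subset by auto
    obtain F where F: "F \<in> D" using DH by auto
    have "\<not> even_cover n H C'" if C': "C' \<subseteq> D - {F}" for C'
    proof
      assume "even_cover n H C'"
      then have "P C'" using C' DW by (auto simp: P_def)
      then have "card D \<le> card C'" by (rule min)
      moreover have "card C' < card D"
        using C' F fD by (intro psubset_card_mono) auto
      ultimately show False by simp
    qed
    then obtain f where f: "inj_on f (D - {F})" "\<forall>F\<in>D - {F}. f F \<in> F"
      using rep[of "D - {F}"] DH(1) by (meson Diff_subset order_trans)
    have "f ` (D - {F}) \<subseteq> W" using f DW by (auto simp: induced_edges_def)
    then have "card (D - {F}) \<le> card W" using card_inj_on_le[OF f(1)] W by blast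
    then have "card D \<le> card W + 1" using F fD by (simp add: card_Diff_singleton)
    then show False using no D by (auto simp: P_def)
  qed
  moreover have sub: "induced_edges H W \<subseteq> H" by (auto simp: induced_edges_def)
  ultimately obtain f where "inj_on f (induced_edges H W)" "\<forall>F\<in>induced_edges H W. f F \<in> F"
    using rep[OF sub] by blast
  then show ?thesis by (intro exI[of _ f]) (auto simp: rep_system_def induced_edges_def)
qed

section \<open>The representative orientation\<close>

lemma lift_edge_sym:
  assumes H: "H \<subseteq> nsets {1..n} (2 * r)" and "lift_edge n l r s H F x y"
  shows "lift_edge n l r s H F y x"
proof -
  have F: "finite F" "card F = 2 * r" "card (fst x \<inter> F) = r" and y: "fst y = sym_diff (fst x) F"
    using assms by (auto simp: lift_edge_def nsets_def)
  have "fst y \<inter> F = F - fst x \<inter> F" unfolding y by auto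
  moreover have "card (F - fst x \<inter> F) = r" using F by (subst card_Diff_subset) auto
  ultimately show ?thesis using assms unfolding lift_edge_def by auto
qed

lemma lift_support_bound:
  assumes H: "H \<subseteq> nsets {1..n} k" and "x \<in> lift_pairs n l s H"
  shows "lift_support x \<subseteq> {1..n}" "card (lift_support x) \<le> l + k * s"
proof -
  obtain S M where x: "x = (S, M)" "S \<subseteq> {1..n}" "card S = l" "M \<subseteq> H" "card M \<le> s"
    using assms by (auto simp: lift_pairs_def kikuchi_rows_def nsets_def)
  show "lift_support x \<subseteq> {1..n}" using x H by (fastforce simp: lift_support_def nsets_def)
  have "M \<subseteq> Pow {1..n}" using x H unfolding nsets_def by blast
  then have "finite M" using finite_subset by blast
  then have "card (\<Union> M) \<le> (\<Sum>F\<in>M. card F)" by (intro card_Union_le_sum_card)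
  also have "\<dots> = k * card M" using x H by (simp add: nsets_def subset_iff)
  also have "\<dots> \<le> k * s" using x by simp
  finally show "card (lift_support x) \<le> l + k * s"
    using card_Un_le[of S "\<Union> M"] x by (simp add: lift_support_def)
qed

lemma lift_edge_label_in_support:
  assumes "lift_edge n l r s H F x y"
  shows "F \<subseteq> lift_support x \<or> F \<subseteq> lift_support y"
proof (cases "F \<in> snd x")
  case True
  then show ?thesis by (auto simp: lift_support_def)
next
  case False
  then have "F \<in> snd y" using assms by (auto simp: lift_edge_def)
  then show ?thesis by (auto simp: lift_support_def)
qed

lemma lift_edge_supports_nested:
  assumes "lift_edge n l r s H F x y" "F \<in> snd y"
  shows "lift_support x \<subseteq> lift_support y"
proof -
  have "fst y = sym_diff (fst x) F" "snd y = sym_diff (snd x) {F}"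
    using assms by (auto simp: lift_edge_def)
  then show ?thesis using assms(2) unfolding lift_support_def by blast
qed

text \<open>An edge into \<open>y\<close> with unequal supports removes its label \<open>F\<close> from the memory, and
  some vertex of the row of \<open>y\<close> lies in \<open>F\<close> but in no other member of the memory.\<close>

lemma oriented_edges_into_le:
  assumes H: "H \<subseteq> nsets {1..n} k" and y: "y \<in> lift_pairs n l s H"
    and rep: "rep_system H (lift_support y) (\<rho> (lift_support y))"
  shows "finite {(x, F). lift_edge n l r s H F x y \<and> oriented_toward \<rho> F x y}"
    and "card {(x, F). lift_edge n l r s H F x y \<and> oriented_toward \<rho> F x y} \<le> 2 * l"
proof -
  obtain S M where yS: "y = (S, M)" and S: "finite S" "card S = l"
    using y by (auto simp: lift_pairs_def kikuchi_rows_def nsets_def)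
  define W where "W = lift_support y"
  define E where "E = {(x, F). lift_edge n l r s H F x y \<and> oriented_toward \<rho> F x y}"
  \<comment> \<open>\<open>A\<close> will receive the labels of incoming edges with equal supports,
    \<open>B\<close> those of edges along which the support grows. Each injects into the row
    \<open>S\<close>, by representatives and by private vertices respectively.\<close>
  define A where "A = {F \<in> induced_edges H W. \<rho> W F \<in> S}"
  define B where "B = {F \<in> M. \<exists>v\<in>S. v \<in> F \<and> (\<forall>G\<in>M. v \<in> G \<longrightarrow> G = F)}"
  have injA: "inj_on (\<rho> W) A"
    using rep by (auto simp: A_def W_def rep_system_def inj_on_def)
  have imA: "\<rho> W ` A \<subseteq> S" by (auto simp: A_def)
  have A: "finite A" "card A \<le> l"
    using inj_on_finite[OF injA imA] card_inj_on_le[OF injA imA] S by auto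
  have "\<forall>F\<in>B. \<exists>v. v \<in> S \<and> v \<in> F \<and> (\<forall>G\<in>M. v \<in> G \<longrightarrow> G = F)" by (auto simp: B_def)
  from bchoice[OF this] obtain g
    where g: "\<forall>F\<in>B. g F \<in> S \<and> g F \<in> F \<and> (\<forall>G\<in>M. g F \<in> G \<longrightarrow> G = F)" by blast
  have injB: "inj_on g B"
  proof (rule inj_onI)
    fix F G assume "F \<in> B" "G \<in> B" "g F = g G"
    moreover from this have "G \<in> M" "g F \<in> G" using g by (auto simp: B_def)
    ultimately show "F = G" using g by blast
  qed
  have imB: "g ` B \<subseteq> S" using g by auto
  have B: "finite B" "card B \<le> l"
    using inj_on_finite[OF injB imB] card_inj_on_le[OF injB imB] S by auto
  have label: "F \<in> A \<union> B" if "(x, F) \<in> E" for x F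
  proof -
    have e: "lift_edge n l r s H F x y" and o: "oriented_toward \<rho> F x y"
      using that by (auto simp: E_def)
    have xy: "S = sym_diff (fst x) F" "M = sym_diff (snd x) {F}" and FH: "F \<in> H"
      using e by (auto simp: lift_edge_def yS)
    show ?thesis
    proof (cases "lift_support x = W")
      case True
      then have "F \<subseteq> W" using lift_edge_label_in_support[OF e] by (auto simp: W_def)
      moreover have "\<rho> W F \<in> S" using o True by (auto simp: oriented_toward_def W_def yS)
      ultimately show ?thesis using FH by (auto simp: A_def induced_edges_def)
    next
      case False
      then have sub: "lift_support x \<subset> W" using o by (auto simp: oriented_toward_def W_def)
      then obtain v where v: "v \<in> W" "v \<notin> lift_support x" by auto
      have W: "W = S \<union> \<Union>M" by (simp add: W_def lift_support_def yS)
      have vx: "v \<notin> fst x" "\<And>G. G \<in> snd x \<Longrightarrow> v \<notin> G"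
        using v(2) by (auto simp: lift_support_def)
      have only: "\<And>G. G \<in> M \<Longrightarrow> v \<in> G \<Longrightarrow> G = F" using vx xy(2) by auto
      \<comment> \<open>If \<open>v\<close> comes from a member of \<open>M\<close>, that member is
        \<open>F\<close>; if it comes from \<open>S\<close>, it was toggled by \<open>F\<close>,
        since it is not in \<open>fst x\<close>.\<close>
      have vF: "v \<in> F" using v(1) only vx(1) unfolding W xy(1) by blast
      have vS: "v \<in> S" unfolding xy(1) using vF vx(1) by auto
      have "F \<notin> snd x" using vx(2) vF by auto
      then have "F \<in> M" using xy(2) by auto
      then show ?thesis using vS vF only unfolding B_def by blast
    qed
  qed
  \<comment> \<open>Toggling is an involution, so \<open>y\<close> and the label determine
    \<open>x\<close>; counting edges reduces to counting labels.\<close>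
  have inj: "inj_on snd E"
  proof (rule inj_onI)
    fix p q assume pq: "p \<in> E" "q \<in> E" "snd p = snd q"
    obtain x F x' where p: "p = (x, F)" "q = (x', F)"
      using pq(3) by (metis prod.collapse)
    have "sym_diff (fst x) F = sym_diff (fst x') F" "sym_diff (snd x) {F} = sym_diff (snd x') {F}"
      using pq(1,2) unfolding p by (simp_all add: E_def lift_edge_def)
    then have "fst x = fst x'" "snd x = snd x'" by blast+
    then show "p = q" by (simp add: p prod_eq_iff)
  qed
  have im: "snd ` E \<subseteq> A \<union> B" 
    by (rule image_subsetI) (metis label prod.collapse)
  show "finite {(x, F). lift_edge n l r s H F x y \<and> oriented_toward \<rho> F x y}"
    using inj_on_finite[OF inj im] A B by (simp add: E_def)
  have "card E \<le> card (A \<union> B)" using card_inj_on_le[OF inj im] A B by simp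
  also have "\<dots> \<le> 2 * l" using card_Un_le[of A B] A B by simp
  finally show "card {(x, F). lift_edge n l r s H F x y \<and> oriented_toward \<rho> F x y} \<le> 2 * l"
    by (simp add: E_def)
qed

text \<open>If the supports agree, both contain \<open>F\<close>, and the representative lies in one
  of the rows because these differ by \<open>F\<close>. Otherwise the endpoint with \<open>F\<close>
  in its memory has the larger support.\<close>

lemma lift_edge_oriented:
  assumes H: "H \<subseteq> nsets {1..n} (2 * r)" and e: "lift_edge n l r s H F x y"
    and rep: "rep_system H (lift_support y) (\<rho> (lift_support y))"
  shows "oriented_toward \<rho> F x y \<or> oriented_toward \<rho> F y x"
proof (cases "lift_support x = lift_support y")
  case True
  have "F \<subseteq> lift_support y" "F \<in> H"
    using True lift_edge_label_in_support[OF e] e by (auto simp: lift_edge_def)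
  then have "\<rho> (lift_support y) F \<in> F" using rep by (auto simp: rep_system_def induced_edges_def)
  moreover have "fst y = sym_diff (fst x) F" using e by (simp add: lift_edge_def)
  ultimately show ?thesis using True by (auto simp: oriented_toward_def)
next
  case False
  have "F \<in> snd y \<or> F \<in> snd x" using e by (auto simp: lift_edge_def)
  then show ?thesis
    using False lift_edge_supports_nested[OF e] lift_edge_supports_nested[OF lift_edge_sym[OF H e]]
    by (auto simp: oriented_toward_def)
qed

section \<open>Norm bounds for matrices\<close>

definition mat_apply :: "'a set \<Rightarrow> ('a \<Rightarrow> 'a \<Rightarrow> real) \<Rightarrow> ('a \<Rightarrow> real) \<Rightarrow> 'a \<Rightarrow> real" where
  "mat_apply I A x = (\<lambda>i. \<Sum>j\<in>I. A i j * x j)"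

lemma sum_mult_L2_set_le:
  "(\<Sum>i\<in>I. x i * y i) \<le> L2_set x I * L2_set y I"
proof -
  have "(\<Sum>i\<in>I. x i * y i) \<le> (\<Sum>i\<in>I. \<bar>x i\<bar> * \<bar>y i\<bar>)"
    by (intro sum_mono) (simp add: abs_mult[symmetric])
  also have "\<dots> \<le> L2_set x I * L2_set y I" by (rule L2_set_mult_ineq)
  finally show ?thesis .
qed

section \<open>Powers of a self-adjoint matrix\<close>

lemma power2_L2_set: "(L2_set x I)\<^sup>2 = (\<Sum>i\<in>I. (x i)\<^sup>2)"
  by (simp add: L2_set_def sum_nonneg)

lemma mat_apply_self_adjoint:
  assumes "\<And>i j. i \<in> I \<Longrightarrow> j \<in> I \<Longrightarrow> A i j = A j i"
  shows "(\<Sum>i\<in>I. mat_apply I A x i * y i) = (\<Sum>i\<in>I. x i * mat_apply I A y i)"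
proof -
  have "(\<Sum>i\<in>I. mat_apply I A x i * y i) = (\<Sum>i\<in>I. \<Sum>j\<in>I. A i j * x j * y i)"
    by (simp add: mat_apply_def sum_distrib_right)
  also have "\<dots> = (\<Sum>j\<in>I. \<Sum>i\<in>I. A i j * x j * y i)" by (rule sum.swap)
  also have "\<dots> = (\<Sum>j\<in>I. \<Sum>i\<in>I. x j * (A j i * y i))"
    using assms by (intro sum.cong refl) auto
  finally show ?thesis by (simp add: mat_apply_def sum_distrib_left)
qed

lemma mat_apply_pow_bound:
  assumes "\<And>x. L2_set (mat_apply I A x) I \<le> c * L2_set x I" "0 \<le> c"
  shows "L2_set ((mat_apply I A ^^ t) x) I \<le> c ^ t * L2_set x I"
proof (induction t)
  case (Suc t)
  have "L2_set ((mat_apply I A ^^ Suc t) x) I \<le> c * L2_set ((mat_apply I A ^^ t) x) I"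
    using assms(1) by simp
  also have "\<dots> \<le> c * (c ^ t * L2_set x I)" using Suc assms(2) by (rule mult_left_mono)
  finally show ?case by (simp add: mult.assoc)
qed simp

text \<open>Where \<open>a\<close> is positive, the ratios \<open>a (Suc t) / a t\<close> are
  nondecreasing, and the first is at least \<open>a 1\<close> because \<open>a 0 \<le> 1\<close>.
  The exponent starts at 1, since at 0 the bound would read \<open>1 \<le> a 0\<close>.\<close>

lemma log_convex_growth:
  fixes a :: "nat \<Rightarrow> real"
  assumes nn: "\<And>t. 0 \<le> a t" and lc: "\<And>t. (a (Suc t))\<^sup>2 \<le> a t * a (Suc (Suc t))"
    and a0: "a 0 \<le> 1"
  shows "a 1 ^ Suc t \<le> a (Suc t)"
proof (cases "a 1 = 0")
  case True
  then show ?thesis using nn[of "Suc t"] by simp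
next
  case False
  have "0 < a (Suc t) \<and> a 1 * a t \<le> a (Suc t)" for t
  proof (induction t)
    case 0
    have "0 < a 1" using False nn[of 1] by linarith
    then show ?case using a0 by (simp add: mult_left_le)
  next
    case (Suc t)
    have pos: "0 < a (Suc t)" and le: "a 1 * a t \<le> a (Suc t)" using Suc by auto
    have "0 < (a (Suc t))\<^sup>2" using pos by simp
    then have at: "0 < a t" "0 < a (Suc (Suc t))"
      using lc[of t] nn[of t] nn[of "Suc (Suc t)"]
      by (smt (verit) mult_eq_0_iff)+
    have "a t * (a 1 * a (Suc t)) = (a 1 * a t) * a (Suc t)" by simp
    also have "\<dots> \<le> a (Suc t) * a (Suc t)" using le pos by (intro mult_right_mono) auto
    also have "\<dots> \<le> a t * a (Suc (Suc t))" using lc[of t] by (simp add: power2_eq_square)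
    finally show ?case using at by simp
  qed
  note step = this
  show ?thesis
  proof (induction t)
    case (Suc t)
    have "a 1 ^ Suc (Suc t) \<le> a 1 * a (Suc t)" using Suc nn[of 1] by (simp add: mult_left_mono)
    also have "\<dots> \<le> a (Suc (Suc t))" using step[of "Suc t"] by simp
    finally show ?case .
  qed simp
qed

text \<open>Moving one factor \<open>A\<close> across the inner product turns the squared norm of an
  iterate into the inner product of its two neighbours; Cauchy-Schwarz then gives
  log-convexity.\<close>

lemma self_adjoint_norm_pow_le:
  assumes sym: "\<And>i j. i \<in> I \<Longrightarrow> j \<in> I \<Longrightarrow> A i j = A j i"
    and x: "L2_set x I \<le> 1" and t: "0 < t"
  shows "L2_set (mat_apply I A x) I ^ t \<le> L2_set ((mat_apply I A ^^ t) x) I"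
proof -
  define y where "y = (\<lambda>t. (mat_apply I A ^^ t) x)"
  have "(L2_set (y (Suc t)) I)\<^sup>2 \<le> L2_set (y t) I * L2_set (y (Suc (Suc t))) I" for t
  proof -
    have "(L2_set (y (Suc t)) I)\<^sup>2 = (\<Sum>i\<in>I. mat_apply I A (y t) i * y (Suc t) i)"
      unfolding power2_L2_set by (simp add: y_def power2_eq_square)
    also have "\<dots> = (\<Sum>i\<in>I. y t i * y (Suc (Suc t)) i)"
      using mat_apply_self_adjoint[OF sym] by (simp add: y_def)
    also have "\<dots> \<le> L2_set (y t) I * L2_set (y (Suc (Suc t))) I" by (rule sum_mult_L2_set_le)
    finally show ?thesis .
  qed
  then have "L2_set (y 1) I ^ Suc t' \<le> L2_set (y (Suc t')) I" for t'
    using log_convex_growth[of "\<lambda>t. L2_set (y t) I"] x by (simp add: y_def L2_set_nonneg)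
  from this[of "t - 1"] t show ?thesis by (simp add: y_def)
qed

section \<open>Expansion of matrix powers into columns\<close>

lemma mat_apply_pow_unit_vectors:
  assumes "finite I" "i \<in> I"
  shows "(mat_apply I A ^^ t) x i =
    (\<Sum>j\<in>I. x j * (mat_apply I A ^^ t) (\<lambda>m. if m = j then 1 else 0) i)"
  using assms(2)
proof (induction t arbitrary: i)
  \<comment> \<open>Here \<open>i \<in> I\<close> matters: outside \<open>I\<close> the sum is 0,
    while the left-hand side is \<open>x i\<close>.\<close>
  case 0
  then show ?case using assms(1) by (simp add: if_distrib[of "(*) _"] cong: if_cong)
next
  case (Suc t)
  let ?e = "\<lambda>j m. if m = j then 1 else (0::real)"
  have "(mat_apply I A ^^ Suc t) x i
      = (\<Sum>m\<in>I. A i m * (\<Sum>j\<in>I. x j * (mat_apply I A ^^ t) (?e j) m))"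
    unfolding funpow.simps comp_apply mat_apply_def[of I A "(mat_apply I A ^^ t) x"]
    using Suc.IH by (intro sum.cong) auto
  also have "\<dots> = (\<Sum>m\<in>I. \<Sum>j\<in>I. x j * (A i m * (mat_apply I A ^^ t) (?e j) m))"
    by (simp add: sum_distrib_left mult_ac)
  also have "\<dots> = (\<Sum>j\<in>I. \<Sum>m\<in>I. x j * (A i m * (mat_apply I A ^^ t) (?e j) m))"
    by (rule sum.swap)
  also have "\<dots> = (\<Sum>j\<in>I. x j * (mat_apply I A ^^ Suc t) (?e j) i)"
    by (simp add: mat_apply_def[of I A "(mat_apply I A ^^ t) _"] sum_distrib_left)
  finally show ?case .
qed

lemma L2_set_sum_le:
  "finite J \<Longrightarrow> L2_set (\<lambda>i. \<Sum>j\<in>J. f j i) I \<le> (\<Sum>j\<in>J. L2_set (f j) I)"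
proof (induction J rule: finite_induct)
  case empty
  show ?case by (simp add: L2_set_def)
next
  case (insert j J)
  have "L2_set (\<lambda>i. f j i + (\<Sum>j\<in>J. f j i)) I \<le> L2_set (f j) I + L2_set (\<lambda>i. \<Sum>j\<in>J. f j i) I"
    by (rule L2_set_triangle_ineq)
  then show ?case using insert by simp
qed

text \<open>The triangle inequality weights the columns by \<open>\<bar>x j\<bar>\<close>, and
  Cauchy-Schwarz bounds the total weight. The factor \<open>sqrt (card I)\<close> is the source of
  \<open>N powr (1 / (2 * s))\<close> after an \<open>s\<close>-th root.\<close>

lemma mat_apply_pow_le_columns:
  assumes fin: "finite I" and c: "0 \<le> c"
    and col: "\<And>j. j \<in> I \<Longrightarrow> L2_set ((mat_apply I A ^^ t) (\<lambda>m. if m = j then 1 else 0)) I \<le> c"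
  shows "L2_set ((mat_apply I A ^^ t) x) I \<le> sqrt (real (card I)) * c * L2_set x I"
proof -
  let ?u = "\<lambda>j. (mat_apply I A ^^ t) (\<lambda>m. if m = j then 1 else 0)"
  have "L2_set ((mat_apply I A ^^ t) x) I = L2_set (\<lambda>i. \<Sum>j\<in>I. x j * ?u j i) I"
    using fin by (intro L2_set_cong refl mat_apply_pow_unit_vectors) auto
  also have "\<dots> \<le> (\<Sum>j\<in>I. L2_set (\<lambda>i. x j * ?u j i) I)" using fin by (rule L2_set_sum_le)
  also have "\<dots> = (\<Sum>j\<in>I. \<bar>x j\<bar> * L2_set (?u j) I)"
    by (simp add: L2_set_def power_mult_distrib sum_distrib_left[symmetric] real_sqrt_mult)
  also have "\<dots> \<le> (\<Sum>j\<in>I. \<bar>x j\<bar> * \<bar>c\<bar>)"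
    using col c by (intro sum_mono mult_left_mono) auto
  also have "\<dots> \<le> L2_set x I * L2_set (\<lambda>_. c) I" by (rule L2_set_mult_ineq)
  also have "L2_set (\<lambda>_. c) I = sqrt (real (card I)) * c"
    using c by (simp add: L2_set_def real_sqrt_mult)
  finally show ?thesis by (simp add: mult_ac)
qed

section \<open>Bilinear forms over oriented edge sets\<close>

lemma sum_relation:
  assumes "finite X" "D \<subseteq> X \<times> X"
  shows "(\<Sum>(x, y)\<in>D. h x y) = (\<Sum>x\<in>X. \<Sum>y\<in>{y. (x, y) \<in> D}. h x y)"
    and "(\<Sum>(x, y)\<in>D. h x y) = (\<Sum>y\<in>X. \<Sum>x\<in>{x. (x, y) \<in> D}. h x y)"
proof -
  have first: "(\<Sum>(x, y)\<in>E. k x y) = (\<Sum>x\<in>X. \<Sum>y\<in>{y. (x, y) \<in> E}. k x y)"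
    if E: "E \<subseteq> X \<times> X" for E k
  proof -
    have "finite {y. (x, y) \<in> E}" for x
      by (rule finite_subset[OF _ assms(1)]) (use E in auto)
    then have "(\<Sum>x\<in>X. \<Sum>y\<in>{y. (x, y) \<in> E}. k x y) = (\<Sum>(x, y)\<in>(SIGMA x:X. {y. (x, y) \<in> E}). k x y)"
      using assms(1) by (intro sum.Sigma) auto
    also have "(SIGMA x:X. {y. (x, y) \<in> E}) = E" using E by auto
    finally show ?thesis by simp
  qed
  show "(\<Sum>(x, y)\<in>D. h x y) = (\<Sum>x\<in>X. \<Sum>y\<in>{y. (x, y) \<in> D}. h x y)"
    using assms(2) by (rule first)
  have "(\<Sum>(x, y)\<in>D. h x y) = (\<Sum>(y, x)\<in>D\<inverse>. h x y)"
    by (rule sum.reindex_bij_witness[of _ prod.swap prod.swap]) auto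
  also have "\<dots> = (\<Sum>y\<in>X. \<Sum>x\<in>{x. (y, x) \<in> D\<inverse>}. h x y)"
    using assms(2) by (intro first) auto
  finally show "(\<Sum>(x, y)\<in>D. h x y) = (\<Sum>y\<in>X. \<Sum>x\<in>{x. (x, y) \<in> D}. h x y)" by simp
qed

text \<open>Cauchy-Schwarz with the weight split between the two ends. A tail \<open>x\<close>
  occurs at most \<open>\<gamma> x\<close> times, which its normalization cancels; a head occurs at
  most \<open>b\<close> times with weight at most \<open>1 / d\<close>. Large out-degrees therefore
  cost nothing.\<close>

lemma oriented_form_bound:
  fixes f g \<gamma> :: "'a \<Rightarrow> real"
  assumes fin: "finite X" and D: "D \<subseteq> X \<times> X" and d: "0 < d"
    and \<gamma>: "\<And>x. x \<in> X \<Longrightarrow> d \<le> \<gamma> x"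
    and outdeg: "\<And>x. x \<in> X \<Longrightarrow> real (card {y. (x, y) \<in> D}) \<le> \<gamma> x"
    and indeg: "\<And>y. y \<in> X \<Longrightarrow> real (card {x. (x, y) \<in> D}) \<le> b"
  shows "(\<Sum>(x, y)\<in>D. \<bar>g x\<bar> * \<bar>f y\<bar> * (\<gamma> x powr (-1/2) * \<gamma> y powr (-1/2)))
    \<le> sqrt (b / d) * L2_set g X * L2_set f X"
proof -
  define p where "p = (\<lambda>(x, y::'a). \<bar>g x\<bar> * \<gamma> x powr (-1/2))"
  define q where "q = (\<lambda>(x::'a, y). \<bar>f y\<bar> * \<gamma> y powr (-1/2))"
  have sq: "(\<gamma> x powr (-1/2))\<^sup>2 = 1 / \<gamma> x" if "x \<in> X" for x
  proof -
    have "0 < \<gamma> x" using \<gamma>[OF that] d by linarith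
    then show ?thesis
      by (simp add: power2_eq_square powr_add[symmetric] powr_minus_divide)
  qed
  have "(\<Sum>e\<in>D. (p e)\<^sup>2) = (\<Sum>x\<in>X. \<Sum>y\<in>{y. (x, y) \<in> D}. (g x)\<^sup>2 * (\<gamma> x powr (-1/2))\<^sup>2)"
    unfolding sum_relation(1)[OF fin D, symmetric]
    by (intro sum.cong) (auto simp: p_def power_mult_distrib)
  also have "\<dots> = (\<Sum>x\<in>X. (g x)\<^sup>2 * (real (card {y. (x, y) \<in> D}) / \<gamma> x))"
    by (intro sum.cong refl) (simp only: sq sum_constant, simp)
  also have "\<dots> \<le> (\<Sum>x\<in>X. (g x)\<^sup>2 * 1)"
  proof (intro sum_mono mult_left_mono)
    fix x assume x: "x \<in> X"
    show "real (card {y. (x, y) \<in> D}) / \<gamma> x \<le> 1"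
      using outdeg[OF x] \<gamma>[OF x] d by (simp add: divide_le_eq_1)
  qed auto
  finally have P: "L2_set p D \<le> L2_set g X" by (simp add: L2_set_def)
  have "(\<Sum>e\<in>D. (q e)\<^sup>2) = (\<Sum>y\<in>X. \<Sum>x\<in>{x. (x, y) \<in> D}. (f y)\<^sup>2 * (\<gamma> y powr (-1/2))\<^sup>2)"
    unfolding sum_relation(2)[OF fin D, symmetric]
    by (intro sum.cong) (auto simp: q_def power_mult_distrib)
  also have "\<dots> = (\<Sum>y\<in>X. (f y)\<^sup>2 * (real (card {x. (x, y) \<in> D}) / \<gamma> y))"
    by (intro sum.cong refl) (simp only: sq sum_constant, simp)
  also have "\<dots> \<le> (\<Sum>y\<in>X. (f y)\<^sup>2 * (b / d))"
  proof (intro sum_mono mult_left_mono)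
    fix y assume y: "y \<in> X"
    show "real (card {x. (x, y) \<in> D}) / \<gamma> y \<le> b / d"
      using indeg[OF y] \<gamma>[OF y] d by (intro frac_le) auto
  qed auto
  finally have "L2_set q D \<le> sqrt ((\<Sum>y\<in>X. (f y)\<^sup>2) * (b / d))"
    unfolding L2_set_def sum_distrib_right by (rule real_sqrt_le_mono)
  then have Q: "L2_set q D \<le> sqrt (b / d) * L2_set f X"
    unfolding real_sqrt_mult L2_set_def[symmetric] by (simp only: mult.commute)
  have "(\<Sum>(x, y)\<in>D. \<bar>g x\<bar> * \<bar>f y\<bar> * (\<gamma> x powr (-1/2) * \<gamma> y powr (-1/2)))
      = (\<Sum>e\<in>D. p e * q e)"
    by (intro sum.cong) (auto simp: p_def q_def mult_ac)
  also have "\<dots> \<le> L2_set p D * L2_set q D" by (rule sum_mult_L2_set_le)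
  also have "\<dots> \<le> L2_set g X * (sqrt (b / d) * L2_set f X)"
    using P Q by (intro mult_mono) (auto simp: L2_set_nonneg)
  finally show ?thesis by (simp add: mult_ac)
qed

text \<open>The squared norm of \<open>g = A f\<close> is the form of \<open>A\<close> at
  \<open>g\<close> and \<open>f\<close>. The pairs in \<open>D\<close> and their reversals each
  contribute at most \<open>sqrt (b / d)\<close> times both norms, whence the factor 2, and one norm
  of \<open>g\<close> cancels.\<close>

lemma oriented_operator_bound:
  fixes \<gamma> :: "'a \<Rightarrow> real"
  assumes fin: "finite X" and D: "D \<subseteq> X \<times> X" and d: "0 < d"
    and \<gamma>: "\<And>x. x \<in> X \<Longrightarrow> d \<le> \<gamma> x"
    and outdeg: "\<And>x. x \<in> X \<Longrightarrow> real (card {y. (x, y) \<in> D}) \<le> \<gamma> x"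
    and indeg: "\<And>y. y \<in> X \<Longrightarrow> real (card {x. (x, y) \<in> D}) \<le> b"
    and A: "\<And>x y. A x y =
      (if (x, y) \<in> D \<or> (y, x) \<in> D then \<gamma> x powr (-1/2) * \<gamma> y powr (-1/2) else 0)"
  shows "L2_set (mat_apply X A f) X \<le> 2 * sqrt (b / d) * L2_set f X"
proof -
  define g where "g = mat_apply X A f"
  define w where "w = (\<lambda>x y. \<gamma> x powr (-1/2) * \<gamma> y powr (-1/2))"
  have Aw: "A x y = (if (x, y) \<in> D \<or> (y, x) \<in> D then w x y else 0)" for x y
    by (simp add: A w_def)
  have w0: "0 \<le> w x y" for x y by (simp add: w_def)
  have "(L2_set g X)\<^sup>2 = (\<Sum>x\<in>X. \<Sum>y\<in>X. g x * f y * A x y)"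
  proof -
    have "(g x)\<^sup>2 = (\<Sum>y\<in>X. g x * f y * A x y)" for x
    proof -
      have "g x * g x = g x * (\<Sum>y\<in>X. A x y * f y)" by (simp add: g_def mat_apply_def)
      then show ?thesis by (simp add: power2_eq_square sum_distrib_left mult_ac)
    qed
    then show ?thesis by (simp add: power2_L2_set)
  qed
  also have "\<dots> \<le> (\<Sum>x\<in>X. \<Sum>y\<in>X. (if (x, y) \<in> D then \<bar>g x\<bar> * \<bar>f y\<bar> * w x y else 0)
      + (if (y, x) \<in> D then \<bar>f y\<bar> * \<bar>g x\<bar> * w y x else 0))"
  proof (intro sum_mono)
    fix x y
    have "g x * f y * w x y \<le> \<bar>g x\<bar> * \<bar>f y\<bar> * w x y"
      using w0 by (intro mult_right_mono) (auto simp: abs_mult[symmetric])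
    moreover have "w y x = w x y" by (simp add: w_def)
    moreover have "0 \<le> \<bar>g x\<bar> * \<bar>f y\<bar> * w x y" using w0 by simp
    ultimately show "g x * f y * A x y \<le> (if (x, y) \<in> D then \<bar>g x\<bar> * \<bar>f y\<bar> * w x y else 0)
      + (if (y, x) \<in> D then \<bar>f y\<bar> * \<bar>g x\<bar> * w y x else 0)"
      unfolding Aw by (simp add: mult_ac)
  qed
  also have "\<dots> = (\<Sum>(x, y)\<in>D. \<bar>g x\<bar> * \<bar>f y\<bar> * w x y) + (\<Sum>(x, y)\<in>D. \<bar>f x\<bar> * \<bar>g y\<bar> * w x y)"
  proof -
    have *: "(\<Sum>x\<in>X. \<Sum>y\<in>X. if (x, y) \<in> D then h x y else 0) = (\<Sum>(x, y)\<in>D. h x y)"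
      for h :: "'a \<Rightarrow> 'a \<Rightarrow> real"
    proof -
      have "(\<Sum>x\<in>X. \<Sum>y\<in>X. if (x, y) \<in> D then h x y else 0)
          = (\<Sum>(x, y)\<in>X \<times> X. if (x, y) \<in> D then h x y else 0)"
        by (rule sum.cartesian_product)
      also have "\<dots> = (\<Sum>(x, y)\<in>D. h x y)"
        using fin D by (intro sum.mono_neutral_cong_right) auto
      finally show ?thesis .
    qed
    have "(\<Sum>x\<in>X. \<Sum>y\<in>X. if (y, x) \<in> D then \<bar>f y\<bar> * \<bar>g x\<bar> * w y x else 0)
       = (\<Sum>x\<in>X. \<Sum>y\<in>X. if (x, y) \<in> D then \<bar>f x\<bar> * \<bar>g y\<bar> * w x y else 0)"
      by (rule sum.swap)
    then show ?thesis by (simp add: sum.distrib *)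
  qed
  also have "\<dots> \<le> sqrt (b / d) * L2_set g X * L2_set f X + sqrt (b / d) * L2_set f X * L2_set g X"
    unfolding w_def
    by (intro add_mono oriented_form_bound[OF fin D d \<gamma> outdeg indeg])
  finally have "L2_set g X * L2_set g X \<le> L2_set g X * (2 * sqrt (b / d) * L2_set f X)"
    by (simp add: power2_eq_square mult_ac)
  then have "L2_set g X \<le> 2 * sqrt (b / d) * L2_set f X" if "L2_set g X \<noteq> 0"
    using that L2_set_nonneg[of g X] by simp
  \<comment> \<open>The sign of \<open>sqrt (b / d)\<close> is that of \<open>b\<close>; an
    in-degree bounded by \<open>b\<close> forces \<open>0 \<le> b\<close> once \<open>X\<close> is
    nonempty.\<close>
  moreover have "0 \<le> 2 * sqrt (b / d) * L2_set f X"
  proof (cases "X = {}")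
    case False
    then have "0 \<le> b" using indeg by (metis all_not_in_conv of_nat_0_le_iff order_trans)
    then show ?thesis using d by (simp add: L2_set_nonneg)
  qed simp
  ultimately show ?thesis unfolding g_def[symmetric] by fastforce
qed

section \<open>Comparison of the Kikuchi matrix with the lift\<close>

lemma finite_kikuchi_rows: "finite (kikuchi_rows n l)"
  by (simp add: kikuchi_rows_def finite_imp_finite_nsets)

lemma card_kikuchi_rows: "card (kikuchi_rows n l) = n choose l"
  by (simp add: kikuchi_rows_def card_nsets)

lemma finite_lift_pairs:
  assumes "finite H"
  shows "finite (lift_pairs n l s H)"
  by (rule finite_subset[of _ "kikuchi_rows n l \<times> Pow H"])
     (use assms finite_kikuchi_rows in \<open>auto simp: lift_pairs_def\<close>)

lemma kikuchi_adj_sym: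
  assumes H: "H \<subseteq> nsets {1..n} (2 * r)"
  shows "kikuchi_adj n l r H S T \<longleftrightarrow> kikuchi_adj n l r H T S"
proof -
  have "kikuchi_adj n l r H T S" if adj: "kikuchi_adj n l r H S T" for S T
  proof -
    obtain F where F: "F \<in> H" "card (S \<inter> F) = r" "T = sym_diff S F"
      using adj unfolding kikuchi_adj_def by blast
    have "finite F" "card F = 2 * r" using F H by (auto simp: nsets_def)
    moreover have "T \<inter> F = F - S \<inter> F" unfolding F(3) by auto
    ultimately have "card (T \<inter> F) = r" using F(2) by (simp add: card_Diff_subset)
    moreover have "S = sym_diff T F" unfolding F(3) by auto
    ultimately show ?thesis using adj F(1) unfolding kikuchi_adj_def by blast
  qed
  then show ?thesis by blast
qed

lemma normalized_kikuchi_sym: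
  assumes "H \<subseteq> nsets {1..n} (2 * r)"
  shows "normalized_kikuchi n l r H S T = normalized_kikuchi n l r H T S"
  using kikuchi_adj_sym[OF assms] by (simp add: normalized_kikuchi_def kikuchi_matrix_def)

text \<open>The weights come from the Kikuchi degrees of the rows, not from degrees in the lift, so
  a lifted walk weighs as much as its projection. The matrix is used on all of
  \<open>lift_pairs\<close>, where the in-degree bound already holds.\<close>

definition lift_matrix ::
    "nat \<Rightarrow> nat \<Rightarrow> nat \<Rightarrow> nat \<Rightarrow> nat set set \<Rightarrow> lift_state \<Rightarrow> lift_state \<Rightarrow> real" where
  "lift_matrix n l r s H x y =
     (if \<exists>F. lift_edge n l r s H F x y then normalized_kikuchi n l r H (fst x) (fst y) else 0)"

lemma lift_edge_kikuchi_adj: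
  "lift_edge n l r s H F x y \<Longrightarrow> kikuchi_adj n l r H (fst x) (fst y)"
  by (auto simp: lift_edge_def kikuchi_adj_def lift_pairs_def)

text \<open>The oriented bound with \<open>b = 2 * l\<close> and \<open>d\<close> the average
  degree. In \<open>Gamma_diag\<close> the added average supplies \<open>d \<le> \<gamma> x\<close>,
  and the degree term dominates the out-degree.\<close>

lemma lift_matrix_bound:
  assumes H: "H \<subseteq> nsets {1..n} (2 * r)" and d: "0 < avg_degree n l r H"
    and rep: "\<And>W. W \<subseteq> {1..n} \<Longrightarrow> card W \<le> l + 2 * r * s \<Longrightarrow> rep_system H W (\<rho> W)"
  shows "L2_set (mat_apply (lift_pairs n l s H) (lift_matrix n l r s H) f) (lift_pairs n l s H)
    \<le> 2 * sqrt (2 * real l / avg_degree n l r H) * L2_set f (lift_pairs n l s H)"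
proof (rule oriented_operator_bound)
  define D where
    "D = {(x, y). \<exists>F. lift_edge n l r s H F x y \<and> oriented_toward \<rho> F x y}"
  define \<gamma> where "\<gamma> = (\<lambda>x :: lift_state. Gamma_diag n l r H (fst x))"
  have "H \<subseteq> Pow {1..n}" using H by (auto simp: nsets_def)
  then have "finite H" using finite_subset by blast
  then show "finite (lift_pairs n l s H)" by (rule finite_lift_pairs)
  show "D \<subseteq> lift_pairs n l s H \<times> lift_pairs n l s H" by (auto simp: D_def lift_edge_def)
  show "0 < avg_degree n l r H" by (rule d)
  show "avg_degree n l r H \<le> \<gamma> x" for x by (simp add: \<gamma>_def Gamma_diag_def)
  have rep': "rep_system H (lift_support y) (\<rho> (lift_support y))" if "y \<in> lift_pairs n l s H" for y
    using rep lift_support_bound[OF H that] by simp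
  show "real (card {y. (x, y) \<in> D}) \<le> \<gamma> x" for x
  proof -
    \<comment> \<open>The new row determines the label and hence the new memory.\<close>
    have "inj_on fst {y. (x, y) \<in> D}"
    proof (rule inj_onI)
      fix y y' assume yy: "y \<in> {y. (x, y) \<in> D}" "y' \<in> {y. (x, y) \<in> D}" "fst y = fst y'"
      then obtain F F' where F: "lift_edge n l r s H F x y" "lift_edge n l r s H F' x y'"
        by (auto simp: D_def)
      then have "sym_diff (fst x) F = sym_diff (fst x) F'" using yy(3) by (simp add: lift_edge_def)
      then have "F = F'" by blast
      then show "y = y'" using F yy(3) by (simp add: lift_edge_def prod_eq_iff)
    qed
    moreover have "fst ` {y. (x, y) \<in> D} \<subseteq> {T. kikuchi_adj n l r H (fst x) T}"
      by (auto simp: D_def dest: lift_edge_kikuchi_adj)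
    moreover have "finite {T. kikuchi_adj n l r H (fst x) T}"
      by (rule finite_subset[OF _ finite_kikuchi_rows[of n l]]) (auto simp: kikuchi_adj_def)
    ultimately have "card {y. (x, y) \<in> D} \<le> kikuchi_degree n l r H (fst x)"
      unfolding kikuchi_degree_def by (rule card_inj_on_le)
    then show ?thesis using d by (simp add: \<gamma>_def Gamma_diag_def)
  qed
  show "real (card {x. (x, y) \<in> D}) \<le> 2 * real l" if y: "y \<in> lift_pairs n l s H" for y
  proof -
    let ?E = "{(x, F). lift_edge n l r s H F x y \<and> oriented_toward \<rho> F x y}"
    have E: "finite ?E" "card ?E \<le> 2 * l"
      using oriented_edges_into_le[where \<rho> = \<rho>, OF H y rep'[OF y]] by auto
    have "{x. (x, y) \<in> D} = fst ` ?E" by (force simp: D_def)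
    then have "card {x. (x, y) \<in> D} \<le> card ?E" using E(1) by (simp add: card_image_le)
    then show ?thesis using E(2) by linarith
  qed
  show "lift_matrix n l r s H x y =
      (if (x, y) \<in> D \<or> (y, x) \<in> D then \<gamma> x powr (-1/2) * \<gamma> y powr (-1/2) else 0)" for x y
  proof -
    have "(\<exists>F. lift_edge n l r s H F x y) \<longleftrightarrow> (x, y) \<in> D \<or> (y, x) \<in> D"
    proof
      assume "\<exists>F. lift_edge n l r s H F x y"
      then obtain F where F: "lift_edge n l r s H F x y" by blast
      then have "y \<in> lift_pairs n l s H" by (simp add: lift_edge_def)
      then show "(x, y) \<in> D \<or> (y, x) \<in> D"
        using lift_edge_oriented[where \<rho> = \<rho>, OF H F rep'] lift_edge_sym[OF H F] F by (auto simp: D_def)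
    next
      assume "(x, y) \<in> D \<or> (y, x) \<in> D"
      then show "\<exists>F. lift_edge n l r s H F x y" unfolding D_def using lift_edge_sym[OF H] by blast
    qed
    moreover have "normalized_kikuchi n l r H (fst x) (fst y) = \<gamma> x powr (-1/2) * \<gamma> y powr (-1/2)"
      if "lift_edge n l r s H F x y" for F
      using lift_edge_kikuchi_adj[OF that]
      by (simp add: normalized_kikuchi_def kikuchi_matrix_def \<gamma>_def)
    ultimately show ?thesis unfolding lift_matrix_def by auto
  qed
qed

text \<open>Each step toggles \<open>F\<close> in the memory and its vertices in the row. So the
  memory gains at most one member per step, and its sum over the two-element field records the
  displacement of the row.\<close>

lemma lift_walk_support:
  assumes fH: "finite H"
    and "(mat_apply (lift_pairs n l s H) (lift_matrix n l r s H) ^^ t)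
      (\<lambda>y. if y = (S, {}) then 1 else 0) (T, M) \<noteq> 0"
  shows "M \<subseteq> H \<and> card M \<le> t \<and> odd_part id M = sym_diff S T"
  using assms(2)
proof (induction t arbitrary: T M)
  case 0
  then show ?case by (auto split: if_splits)
next
  case (Suc t)
  let ?f = "(mat_apply (lift_pairs n l s H) (lift_matrix n l r s H) ^^ t)
      (\<lambda>y. if y = (S, {}) then 1 else 0)"
  have "(\<Sum>x\<in>lift_pairs n l s H. lift_matrix n l r s H (T, M) x * ?f x) \<noteq> 0"
    using Suc.prems by (simp add: mat_apply_def[of _ _ ?f])
  then obtain x where "lift_matrix n l r s H (T, M) x * ?f x \<noteq> 0"
    using sum.not_neutral_contains_not_neutral by blast
  then have ne: "lift_matrix n l r s H (T, M) x \<noteq> 0" "?f x \<noteq> 0" by auto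
  obtain T' M' where x: "x = (T', M')" by force
  obtain F where F: "lift_edge n l r s H F (T, M) (T', M')"
    using ne(1) unfolding x lift_matrix_def by (auto split: if_splits)
  have IH: "M' \<subseteq> H" "card M' \<le> t" "odd_part id M' = sym_diff S T'"
    using Suc.IH[OF ne(2)[unfolded x]] by blast+
  have TT: "T' = sym_diff T F" "M' = sym_diff M {F}" "F \<in> H"
    using F by (auto simp: lift_edge_def)
  have M: "M = sym_diff M' {F}" unfolding TT(2) by blast
  have finM': "finite M'" using IH(1) fH finite_subset by blast
  have "card M \<le> card (insert F M')" using finM' unfolding M by (intro card_mono) auto
  also have "\<dots> \<le> Suc t" using IH(2) finM' by (simp add: card_insert_if)
  finally have "card M \<le> Suc t" .
  moreover have "M \<subseteq> H" unfolding M using IH(1) TT(3) by auto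
  moreover have "odd_part id M = sym_diff (sym_diff S T') F"
    unfolding M using finM' IH(3) by (simp only: odd_part_sym_diff finite.intros odd_part_singleton id_apply)
  moreover have "sym_diff (sym_diff S T') F = sym_diff S T" unfolding TT(1) by blast
  ultimately show ?case by blast
qed

text \<open>A walk of at most \<open>s\<close> steps from \<open>S\<close> has exactly one lift from
  \<open>(S, {})\<close>: the labels force the memory, and truncation is not yet felt. Summing over
  final memories forgets the lift.\<close>

lemma kikuchi_walk_eq_sum_lift_walk:
  assumes fH: "finite H" and "t \<le> s" "T \<in> kikuchi_rows n l"
  shows "(mat_apply (kikuchi_rows n l) (normalized_kikuchi n l r H) ^^ t)
      (\<lambda>T. if T = S then 1 else 0) T =
    (\<Sum>M | M \<subseteq> H \<and> card M \<le> s. (mat_apply (lift_pairs n l s H) (lift_matrix n l r s H) ^^ t)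
      (\<lambda>y. if y = (S, {}) then 1 else 0) (T, M))"
  using assms(2,3)
proof (induction t arbitrary: T)
  case 0
  define Q where "Q = {M. M \<subseteq> H \<and> card M \<le> s}"
  have "finite Q" "{} \<in> Q" using fH by (auto simp: Q_def)
  then have "(\<Sum>M\<in>Q. if (T, M) = (S, {}) then 1 else 0) = (if T = S then 1 else (0::real))"
    by (cases "T = S") simp_all
  then show ?case by (simp add: Q_def)
next
  case (Suc t)
  let ?K = "normalized_kikuchi n l r H"
  let ?L = "lift_matrix n l r s H"
  let ?X = "lift_pairs n l s H"
  let ?R = "kikuchi_rows n l"
  define g where "g = (mat_apply ?R ?K ^^ t) (\<lambda>T. if T = S then 1 else 0)"
  define f where "f = (mat_apply ?X ?L ^^ t) (\<lambda>y. if y = (S, {}) then 1 else 0)"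
  define Q where "Q = {M. M \<subseteq> H \<and> card M \<le> s}"
  have finQ: "finite Q" using fH by (simp add: Q_def)
  have X: "?X = ?R \<times> Q" by (auto simp: lift_pairs_def Q_def)
  have g: "g T' = (\<Sum>M\<in>Q. f (T', M))" if "T' \<in> ?R" for T'
    using Suc.IH[of T'] Suc.prems(1) that by (simp add: g_def f_def Q_def)
  \<comment> \<open>If \<open>(T', M')\<close> is reached, its memory has at most
    \<open>t < s\<close> members, so \<open>sym_diff M' {F}\<close> is still admissible; it is the
    only memory joining row \<open>T\<close> to \<open>(T', M')\<close>.\<close>
  have key: "(\<Sum>M\<in>Q. ?L (T, M) (T', M')) * f (T', M') = ?K T T' * f (T', M')"
    if T': "T' \<in> ?R" and M': "M' \<in> Q" for T' M'
  proof (cases "f (T', M') = 0 \<or> \<not> kikuchi_adj n l r H T T'")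
    case True
    moreover have "?L (T, M) (T', M') = 0" if "\<not> kikuchi_adj n l r H T T'" for M
      using that lift_edge_kikuchi_adj[of n l r s H _ "(T, M)" "(T', M')"]
      by (auto simp: lift_matrix_def)
    ultimately show ?thesis by (auto simp: normalized_kikuchi_def kikuchi_matrix_def)
  next
    case False
    then obtain F where F: "F \<in> H" "card (T \<inter> F) = r" "T' = sym_diff T F"
      by (auto simp: kikuchi_adj_def)
    have "card M' \<le> t" using lift_walk_support[OF fH] False unfolding f_def by blast
    have finM': "finite M'" using M' fH finite_subset by (auto simp: Q_def)
    let ?M = "sym_diff M' {F}"
    have "card ?M \<le> card (insert F M')" using finM' by (intro card_mono) auto
    also have "\<dots> \<le> s" using \<open>card M' \<le> t\<close> Suc.prems(1) finM' by (simp add: card_insert_if)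
    finally have MQ: "?M \<in> Q" using F(1) M' by (auto simp: Q_def)
    have "?L (T, M) (T', M') = (if M = ?M then ?K T T' else 0)" if "M \<in> Q" for M
    proof -
      have "(\<exists>G. lift_edge n l r s H G (T, M) (T', M')) \<longleftrightarrow> M = ?M"
      proof
        assume "\<exists>G. lift_edge n l r s H G (T, M) (T', M')"
        then obtain G where G: "sym_diff T F = sym_diff T G" "M' = sym_diff M {G}"
          unfolding F(3) by (auto simp: lift_edge_def)
        have "G = F" using G(1) by blast
        then show "M = ?M" unfolding G(2) by blast
      next
        assume M: "M = ?M"
        have "M' = sym_diff M {F}" unfolding M by blast
        then have "lift_edge n l r s H F (T, M) (T', M')"
          using F Suc.prems(2) T' M' that by (simp add: lift_edge_def X)
        then show "\<exists>G. lift_edge n l r s H G (T, M) (T', M')" by blast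
      qed
      then show ?thesis by (simp add: lift_matrix_def)
    qed
    then have "(\<Sum>M\<in>Q. ?L (T, M) (T', M')) = (\<Sum>M\<in>Q. if M = ?M then ?K T T' else 0)"
      by (intro sum.cong) auto
    also have "\<dots> = ?K T T'" using finQ MQ by simp
    finally show ?thesis by simp
  qed
  have "(\<Sum>M\<in>Q. (mat_apply ?X ?L f) (T, M)) = (\<Sum>M\<in>Q. \<Sum>T'\<in>?R. \<Sum>M'\<in>Q. ?L (T, M) (T', M') * f (T', M'))"
    by (simp add: mat_apply_def X sum.cartesian_product case_prod_unfold)
  also have "\<dots> = (\<Sum>T'\<in>?R. \<Sum>M\<in>Q. \<Sum>M'\<in>Q. ?L (T, M) (T', M') * f (T', M'))"
    by (rule sum.swap)
  also have "\<dots> = (\<Sum>T'\<in>?R. \<Sum>M'\<in>Q. (\<Sum>M\<in>Q. ?L (T, M) (T', M')) * f (T', M'))"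
    by (subst sum.swap[of _ Q Q]) (simp add: sum_distrib_right)
  also have "\<dots> = (\<Sum>T'\<in>?R. \<Sum>M'\<in>Q. ?K T T' * f (T', M'))"
    using key by (intro sum.cong refl) auto
  also have "\<dots> = mat_apply ?R ?K g T"
    using g by (simp add: mat_apply_def sum_distrib_left)
  finally show ?case by (simp add: f_def g_def Q_def)
qed

lemma sum_power2_at_most_one:
  fixes f :: "'a \<Rightarrow> real"
  assumes "finite Q" "\<And>M M'. M \<in> Q \<Longrightarrow> M' \<in> Q \<Longrightarrow> f M \<noteq> 0 \<Longrightarrow> f M' \<noteq> 0 \<Longrightarrow> M = M'"
  shows "(\<Sum>M\<in>Q. f M)\<^sup>2 = (\<Sum>M\<in>Q. (f M)\<^sup>2)"
proof (cases "\<exists>M\<in>Q. f M \<noteq> 0")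
  case True
  then obtain M where M: "M \<in> Q" "f M \<noteq> 0" by blast
  have z: "f M' = 0" if "M' \<in> Q - {M}" for M' using assms(2)[of M M'] M that by auto
  have "(\<Sum>M\<in>Q. f M) = f M" "(\<Sum>M\<in>Q. (f M)\<^sup>2) = (f M)\<^sup>2"
    using z by (simp_all add: sum.remove[OF assms(1) M(1)])
  then show ?thesis by simp
qed simp

text \<open>Projection to rows adds entries over memories. Since the row determines the final
  memory, no two nonzero entries are merged and the norm is preserved; the lifted bound is then
  iterated \<open>s\<close> times.\<close>

lemma kikuchi_column_bound:
  assumes H: "H \<subseteq> nsets {1..n} (2 * r)" and S: "S \<in> kikuchi_rows n l"
    and no: "\<not> (\<exists>C. even_cover n H C \<and> card C \<le> 2 * s)"
    and c: "0 \<le> c" and bound: "\<And>f. L2_set (mat_apply (lift_pairs n l s H) (lift_matrix n l r s H) f)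
      (lift_pairs n l s H) \<le> c * L2_set f (lift_pairs n l s H)"
  shows "L2_set ((mat_apply (kikuchi_rows n l) (normalized_kikuchi n l r H) ^^ s)
      (\<lambda>T. if T = S then 1 else 0)) (kikuchi_rows n l) \<le> c ^ s"
proof -
  let ?X = "lift_pairs n l s H"
  let ?R = "kikuchi_rows n l"
  have HP: "H \<subseteq> Pow {1..n}" using H by (auto simp: nsets_def)
  then have fH: "finite H" using finite_subset by blast
  define Q where "Q = {M. M \<subseteq> H \<and> card M \<le> s}"
  have finQ: "finite Q" using fH by (simp add: Q_def)
  have X: "?X = ?R \<times> Q" by (auto simp: lift_pairs_def Q_def)
  define e where "e = (\<lambda>y. if y = (S, {} :: nat set set) then 1 else 0 :: real)"
  define f where "f = (mat_apply ?X (lift_matrix n l r s H) ^^ s) e"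
  define g where "g = (mat_apply ?R (normalized_kikuchi n l r H) ^^ s) (\<lambda>T. if T = S then 1 else 0)"
  \<comment> \<open>Two walks from \<open>S\<close> to \<open>T\<close> end with memories whose symmetric difference would be an
      even cover of size at most \<open>2 * s\<close>, so the memory is determined by \<open>T\<close>.\<close>
  have uniq: "M = M'" if f: "f (T, M) \<noteq> 0" "f (T, M') \<noteq> 0" for T M M'
  proof (rule ccontr)
    assume "M \<noteq> M'"
    have M: "M \<subseteq> H" "card M \<le> s" "odd_part id M = sym_diff S T"
      and M': "M' \<subseteq> H" "card M' \<le> s" "odd_part id M' = sym_diff S T"
      using lift_walk_support[OF fH] f unfolding f_def e_def by blast+
    have fin: "finite M" "finite M'" using finite_subset[OF M(1) fH] finite_subset[OF M'(1) fH] by auto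
    have "odd_part id (sym_diff M M') = {}"
      unfolding odd_part_sym_diff[OF fin] M(3) M'(3) by simp
    moreover have "sym_diff M M' \<noteq> {}" using \<open>M \<noteq> M'\<close> by auto
    moreover have "sym_diff M M' \<subseteq> H" using M(1) M'(1) by auto
    ultimately have "even_cover n H (sym_diff M M')"
      unfolding even_cover_iff_odd_part[OF HP] by blast
    moreover have "card (sym_diff M M') \<le> 2 * s"
    proof -
      have "card (sym_diff M M') \<le> card (M \<union> M')" using fin by (intro card_mono) auto
      also have "\<dots> \<le> card M + card M'" by (rule card_Un_le)
      finally show ?thesis using M(2) M'(2) by linarith
    qed
    ultimately show False using no by blast
  qed
  have "(\<Sum>T\<in>?R. (g T)\<^sup>2) = (\<Sum>T\<in>?R. (\<Sum>M\<in>Q. f (T, M))\<^sup>2)"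
    using kikuchi_walk_eq_sum_lift_walk[OF fH order_refl]
    by (intro sum.cong refl) (simp add: f_def g_def e_def Q_def)
  also have "\<dots> = (\<Sum>T\<in>?R. \<Sum>M\<in>Q. (f (T, M))\<^sup>2)"
    using uniq finQ by (intro sum.cong refl sum_power2_at_most_one) auto
  also have "\<dots> = (\<Sum>x\<in>?X. (f x)\<^sup>2)"
    by (simp add: X sum.cartesian_product case_prod_unfold)
  finally have "L2_set g ?R = L2_set f ?X" by (simp add: L2_set_def)
  also have "\<dots> \<le> c ^ s * L2_set e ?X"
    unfolding f_def using bound c by (rule mat_apply_pow_bound)
  also have "L2_set e ?X = 1"
  proof -
    have "(\<Sum>x\<in>?X. (e x)\<^sup>2) = (\<Sum>x\<in>?X. if x = (S, {}) then 1 else 0)"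
      by (intro sum.cong) (auto simp: e_def)
    also have "\<dots> = 1"
    proof -
      have "(S, {}) \<in> ?X" using S by (simp add: lift_pairs_def)
      then show ?thesis using finite_lift_pairs[OF fH] by simp
    qed
    finally show ?thesis by (simp add: L2_set_def)
  qed
  finally show ?thesis by (simp add: g_def)
qed

text \<open>On the unit ball, the \<open>s\<close>-th power of the norm of \<open>K x\<close> is at
  most the norm of \<open>K ^ s x\<close>, which the columns bound by \<open>sqrt N * c ^ s\<close>;
  an \<open>s\<close>-th root finishes.\<close>

lemma op_norm_on_kikuchi_le:
  assumes H: "H \<subseteq> nsets {1..n} (2 * r)" and s: "0 < s"
    and no: "\<not> (\<exists>C. even_cover n H C \<and> card C \<le> 2 * s)"
    and c: "0 \<le> c" and bound: "\<And>f. L2_set (mat_apply (lift_pairs n l s H) (lift_matrix n l r s H) f)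
      (lift_pairs n l s H) \<le> c * L2_set f (lift_pairs n l s H)"
  shows "op_norm_on (kikuchi_rows n l) (normalized_kikuchi n l r H)
    \<le> c * real (n choose l) powr (1 / (2 * real s))"
  unfolding op_norm_on_def
proof (rule cSUP_least)
  have "L2_set (\<lambda>_. 0) (kikuchi_rows n l) \<le> 1" by (simp add: L2_set_def)
  then show "{x. L2_set x (kikuchi_rows n l) \<le> 1} \<noteq> {}" by blast
next
  let ?R = "kikuchi_rows n l"
  let ?K = "normalized_kikuchi n l r H"
  let ?N = "real (n choose l)"
  fix x assume "x \<in> {x. L2_set x ?R \<le> 1}"
  then have x: "L2_set x ?R \<le> 1" by simp
  have "L2_set (mat_apply ?R ?K x) ?R ^ s \<le> L2_set ((mat_apply ?R ?K ^^ s) x) ?R"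
    using normalized_kikuchi_sym[OF H] x s by (intro self_adjoint_norm_pow_le)
  also have "\<dots> \<le> sqrt (real (card ?R)) * c ^ s * L2_set x ?R"
    using kikuchi_column_bound[OF H _ no c bound] c finite_kikuchi_rows
    by (intro mat_apply_pow_le_columns) auto
  also have "\<dots> \<le> sqrt ?N * c ^ s"
    using x c by (simp add: card_kikuchi_rows mult_left_le)
  also have "\<dots> = (c * ?N powr (1 / (2 * real s))) ^ s"
  proof -
    have "(?N powr (1 / (2 * real s))) ^ s = ?N powr (1 / 2)"
      using s by (cases "?N = 0") (auto simp: powr_power simp del: of_nat_eq_0_iff)
    also have "\<dots> = sqrt ?N" by (simp add: powr_half_sqrt)
    finally show ?thesis by (simp add: power_mult_distrib)
  qed
  finally show "L2_set (\<lambda>i. \<Sum>j\<in>?R. ?K i j * x j) ?R \<le> c * ?N powr (1 / (2 * real s))"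
    using c s by (simp add: mat_apply_def power_mono_iff L2_set_nonneg)
qed

text \<open>Degrees are nonnegative, so a zero sum leaves no edges. The condition
  \<open>n choose l \<noteq> 0\<close> ensures that the zero average comes from the sum and not from
  division by zero.\<close>

lemma op_norm_on_kikuchi_avg_degree_0:
  assumes "avg_degree n l r H = 0" "n choose l \<noteq> 0"
  shows "op_norm_on (kikuchi_rows n l) (normalized_kikuchi n l r H) = 0"
proof -
  have "(\<Sum>S\<in>kikuchi_rows n l. real (kikuchi_degree n l r H S)) = 0"
    using assms by (simp add: avg_degree_def)
  then have deg: "kikuchi_degree n l r H S = 0" if "S \<in> kikuchi_rows n l" for S
    using that finite_kikuchi_rows by (simp add: sum_nonneg_eq_0_iff)
  have "\<not> kikuchi_adj n l r H S T" if "S \<in> kikuchi_rows n l" for S T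
  proof -
    have "finite {T. kikuchi_adj n l r H S T}"
      by (rule finite_subset[OF _ finite_kikuchi_rows[of n l]]) (auto simp: kikuchi_adj_def)
    then show ?thesis using deg[OF that] by (auto simp: kikuchi_degree_def)
  qed
  then have "normalized_kikuchi n l r H S T = 0" if "S \<in> kikuchi_rows n l" for S T
    using that by (simp add: normalized_kikuchi_def kikuchi_matrix_def)
  then have "L2_set (\<lambda>S. \<Sum>T\<in>kikuchi_rows n l. normalized_kikuchi n l r H S T * x T) (kikuchi_rows n l) = 0"
    for x by (simp add: L2_set_def)
  moreover have "L2_set (\<lambda>_. 0) (kikuchi_rows n l) \<le> 1" by (simp add: L2_set_def)
  then have "{x. L2_set x (kikuchi_rows n l) \<le> 1} \<noteq> {}" by blast
  ultimately show ?thesis by (simp add: op_norm_on_def)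
qed

theorem lemma2p7:
  fixes k r l n s N :: nat and H :: "nat set set"
  assumes "k = 2 * r" and "k \<ge> 4"
    and "l > 0" and "n > 0" and "2 * k \<le> l" and "n \<ge> 100 * k * l"
    and "s = nat \<lceil>3 * real l / real k * ln (exp 1 * real n / real l)\<rceil>"
    and "N = n choose l"
    and "H \<subseteq> nsets {1..n} k" and "H \<noteq> {}"
    and "\<not> (\<exists>C. even_cover n H C \<and> card C \<le> max (2 * s) (l + k * s + 1))"
  shows "(\<forall>\<rho>. (\<forall>W. W \<subseteq> {1..n} \<and> card W \<le> l + k * s \<longrightarrow> rep_system H W (\<rho> W)) \<longrightarrow>
            (\<forall>x\<in>lift_states n l r s H. lift_in_degree n l r s H \<rho> x \<le> 2 * l)) \<and>
         op_norm_on (kikuchi_rows n l) (normalized_kikuchi n l r H)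
           \<le> 2 * sqrt (2 * real l / avg_degree n l r H) * real N powr (1 / (2 * real s))"
proof (intro conjI allI impI ballI)
  have H: "H \<subseteq> nsets {1..n} (2 * r)" using assms by simp
  fix \<rho> y
  assume rep: "\<forall>W. W \<subseteq> {1..n} \<and> card W \<le> l + k * s \<longrightarrow> rep_system H W (\<rho> W)"
    and "y \<in> lift_states n l r s H"
  then obtain S where S: "S \<in> kikuchi_rows n l"
    "(\<lambda>u v. \<exists>F. lift_edge n l r s H F u v)\<^sup>*\<^sup>* (S, {}) y"
    by (auto simp: lift_states_def)
  have y: "y \<in> lift_pairs n l s H"
    using S(2,1) by (cases rule: rtranclp.cases) (auto simp: lift_pairs_def lift_edge_def)
  let ?E = "{(x, F). lift_edge n l r s H F x y \<and> oriented_toward \<rho> F x y}"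
  have "rep_system H (lift_support y) (\<rho> (lift_support y))"
    using rep lift_support_bound[OF H y] assms(1) by simp
  note E = oriented_edges_into_le[where \<rho> = \<rho>, OF H y this]
  have "lift_in_degree n l r s H \<rho> y \<le> card ?E"
    unfolding lift_in_degree_def by (rule card_mono[OF E(1)]) auto
  also have "\<dots> \<le> 2 * l" by (rule E(2))
  finally show "lift_in_degree n l r s H \<rho> y \<le> 2 * l" .
next
  have H: "H \<subseteq> nsets {1..n} (2 * r)" using assms by simp
  then have HP: "H \<subseteq> Pow {1..n}" by (auto simp: nsets_def)
  have "1 * l \<le> 100 * k * l" using assms(2) by (intro mult_le_mono1) auto
  then have ln: "l \<le> n" using assms(6) by linarith
  \<comment> \<open>This makes \<open>s\<close> positive, as the \<open>s\<close>-th root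
    requires.\<close>
  have "0 < ln (exp 1 * real n / real l)"
  proof -
    have "1 < exp (1::real)" by simp
    moreover have "1 \<le> real n / real l" using ln assms(3) by simp
    ultimately have "1 < exp 1 * (real n / real l)" by (smt (verit) mult_le_cancel_left1)
    then show ?thesis by simp
  qed
  then have s: "0 < s" using assms(2,3,7) by simp
  let ?d = "avg_degree n l r H"
  let ?c = "2 * sqrt (2 * real l / ?d)"
  have d: "0 \<le> ?d" by (simp add: avg_degree_def sum_nonneg)
  show "op_norm_on (kikuchi_rows n l) (normalized_kikuchi n l r H)
      \<le> ?c * real N powr (1 / (2 * real s))"
  proof (cases "?d = 0")
    \<comment> \<open>Division by \<open>?d = 0\<close> gives 0, so the claimed bound is 0 and the
      norm itself must vanish.\<close>
    case True
    then show ?thesis using op_norm_on_kikuchi_avg_degree_0[OF True] ln by simp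
  next
    case False
    \<comment> \<open>The norm bound mentions no orientation, so any choice of representative
      systems serves; the absence of small even covers provides one.\<close>
    have "\<exists>f. rep_system H W f" if "W \<subseteq> {1..n}" "card W \<le> l + k * s" for W
    proof (rule rep_system_exists[OF HP])
      show "finite W" using that(1) finite_subset by blast
      have "card W + 1 \<le> max (2 * s) (l + k * s + 1)" using that(2) by simp
      then show "\<not> (\<exists>C. even_cover n H C \<and> card C \<le> card W + 1)"
        using assms(11) order_trans by blast
    qed
    then obtain \<rho> where "\<And>W. W \<subseteq> {1..n} \<Longrightarrow> card W \<le> l + k * s \<Longrightarrow> rep_system H W (\<rho> W)"
      by metis
    then have "L2_set (mat_apply (lift_pairs n l s H) (lift_matrix n l r s H) f) (lift_pairs n l s H)
        \<le> ?c * L2_set f (lift_pairs n l s H)" for f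
      using False d assms(1) by (intro lift_matrix_bound[OF H, of l s \<rho>]) auto
    moreover have "\<not> (\<exists>C. even_cover n H C \<and> card C \<le> 2 * s)"
      using assms(11) by (meson max.coboundedI1)
    ultimately show ?thesis
      using op_norm_on_kikuchi_le[OF H s, of ?c] d assms(8) by simp
  qed
qed

end
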